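(* Let $R$ and $S$ be finite-dimensional quantum systems with Hamiltonians $H_R$ and $H_S$, and let $H_{RS}=H_R\otimes\mathbf{1}_S+\mathbf{1}_R\otimes H_S$. Let $\rho_R$ be any state on $R$, let $\rho_S$ be a state on $S$ with $[\rho_S,H_S]=0$, and let $\mathcal{E}$ be a time-translation covariant channel on $RS$. If $\mathcal{E}(\rho_R\otimes\rho_S)=\rho_R|\rho'_S$, i.e. ${\rm Tr}_S\,\mathcal{E}(\rho_R\otimes\rho_S)=\rho_R$ and $\rho'_S:={\rm Tr}_R\,\mathcal{E}(\rho_R\otimes\rho_S)$, then $[\rho'_S,H_S]=0$. In particular, quantum coherence can neither be broadcast nor cloned: there are no $\rho_R$, $\rho_S$ with $[\rho_S,H_S]=0$ and time-translation covariant $\mathcal{E}$ with $\mathcal{E}(\rho_R\otimes\rho_S)=\rho_R|\rho'_S$ and $[\rho'_S,H_S]\neq0$ (and a fortiori none with $\mathcal{E}(\rho_R\otimes\rho_S)=\rho_R\otimes\rho'_S$ and $[\rho'_S,H_S]\neq 0$).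
   Context: A channel is a completely positive trace-preserving map. For a system $X$ with Hamiltonian $H_X$, write $\mathcal{U}^X_t(\sigma)=e^{-itH_X}\sigma e^{itH_X}$ for $t\in\mathbb{R}$. A channel $\mathcal{E}$ on $RS$ is time-translation covariant if $\mathcal{E}\circ(\mathcal{U}^R_t\otimes\mathcal{U}^S_t)=(\mathcal{U}^R_t\otimes\mathcal{U}^S_t)\circ\mathcal{E}$ for all $t\in\mathbb{R}$. The notation $\rho_R|\rho'_S$ denotes some (possibly correlated) bipartite state on $RS$ whose reduced states are $\rho_R$ on $R$ and $\rho'_S$ on $S$. *)

theory Defs
  imports "HOL-Analysis.Analysis"
begin

text \<open>Operators on a finite-dimensional Hilbert space with orthonormal basis indexed by the
finite type 'n are matrices of type complex^'n^'n. The composite system RS is indexed by 'r \<times> 's.\<close>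

type_synonym 'n op = "complex^'n^'n"

definition smat :: "complex \<Rightarrow> ('n::finite) op \<Rightarrow> 'n op" where
  "smat c A = (\<chi> i j. c * A$i$j)"

definition adj :: "('n::finite) op \<Rightarrow> 'n op" where
  "adj A = (\<chi> i j. cnj (A$j$i))"

definition hermitian :: "('n::finite) op \<Rightarrow> bool" where
  "hermitian A \<longleftrightarrow> adj A = A"

definition quad_form :: "('n::finite) op \<Rightarrow> complex^'n \<Rightarrow> complex" where
  "quad_form A v = (\<Sum>i\<in>UNIV. \<Sum>j\<in>UNIV. cnj (v$i) * A$i$j * v$j)"

text \<open>Positive semidefinite: <v, A v> is a nonnegative real for all v.\<close>
definition psd :: "('n::finite) op \<Rightarrow> bool" where
  "psd A \<longleftrightarrow> (\<forall>v. Im (quad_form A v) = 0 \<and> Re (quad_form A v) \<ge> 0)"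

definition is_state :: "('n::finite) op \<Rightarrow> bool" where
  "is_state \<rho> \<longleftrightarrow> psd \<rho> \<and> trace \<rho> = 1"

text \<open>Kronecker (tensor) product and partial traces.\<close>
definition kron :: "('a::finite) op \<Rightarrow> ('b::finite) op \<Rightarrow> ('a \<times> 'b) op" where
  "kron A B = (\<chi> p q. A$(fst p)$(fst q) * B$(snd p)$(snd q))"

definition ptrace_2 :: "('a::finite \<times> 'b::finite) op \<Rightarrow> 'a op" where
  "ptrace_2 X = (\<chi> i j. \<Sum>k\<in>UNIV. X$(i,k)$(j,k))"

definition ptrace_1 :: "('a::finite \<times> 'b::finite) op \<Rightarrow> 'b op" where
  "ptrace_1 X = (\<chi> k l. \<Sum>i\<in>UNIV. X$(i,k)$(i,l))"

text \<open>Matrix exponential, defined by its power series entrywise.\<close>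
definition mpow :: "('n::finite) op \<Rightarrow> nat \<Rightarrow> 'n op" where
  "mpow A k = (((**) A) ^^ k) (mat 1)"

definition mexp :: "('n::finite) op \<Rightarrow> 'n op" where
  "mexp A = (\<chi> i j. (\<Sum>k. (mpow A k)$i$j / of_nat (fact k)))"

text \<open>Time evolution U_t(sigma) = exp(-itH) sigma exp(itH).\<close>
definition evol :: "('n::finite) op \<Rightarrow> real \<Rightarrow> 'n op \<Rightarrow> 'n op" where
  "evol H t \<sigma> = mexp (smat (- \<i> * of_real t) H) ** \<sigma> ** mexp (smat (\<i> * of_real t) H)"

text \<open>Channels: complex-linear, trace-preserving, completely positive maps.
Complete positivity: id_n \<otimes> E is positive for every ancilla dimension n; an operator on
C^n \<otimes> H is represented by its n \<times> n blocks X k l (k,l < n).\<close>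
definition clinear_map :: "(('n::finite) op \<Rightarrow> ('m::finite) op) \<Rightarrow> bool" where
  "clinear_map E \<longleftrightarrow> (\<forall>X Y. E (X + Y) = E X + E Y) \<and> (\<forall>c X. E (smat c X) = smat c (E X))"

definition psd_block :: "nat \<Rightarrow> (nat \<Rightarrow> nat \<Rightarrow> ('n::finite) op) \<Rightarrow> bool" where
  "psd_block n X \<longleftrightarrow> (\<forall>v :: nat \<Rightarrow> complex^'n.
     let q = (\<Sum>k<n. \<Sum>l<n. \<Sum>i\<in>UNIV. \<Sum>j\<in>UNIV. cnj (v k $ i) * (X k l)$i$j * (v l $ j))
     in Im q = 0 \<and> Re q \<ge> 0)"

definition completely_positive :: "(('n::finite) op \<Rightarrow> ('m::finite) op) \<Rightarrow> bool" where
  "completely_positive E \<longleftrightarrow>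
     (\<forall>n X. psd_block n X \<longrightarrow> psd_block n (\<lambda>k l. E (X k l)))"

definition channel :: "(('n::finite) op \<Rightarrow> ('m::finite) op) \<Rightarrow> bool" where
  "channel E \<longleftrightarrow> clinear_map E \<and> (\<forall>X. trace (E X) = trace X) \<and> completely_positive E"

definition ham_sum :: "('r::finite) op \<Rightarrow> ('s::finite) op \<Rightarrow> ('r \<times> 's) op" where
  "ham_sum HR HS = kron HR (mat 1) + kron (mat 1) HS"

text \<open>(U^R_t \<otimes> U^S_t)(sigma) = exp(-it H_RS) sigma exp(it H_RS).\<close>
definition tt_covariant :: "('r::finite) op \<Rightarrow> ('s::finite) op \<Rightarrow> (('r \<times> 's) op \<Rightarrow> ('r \<times> 's) op) \<Rightarrow> bool" where
  "tt_covariant HR HS E \<longleftrightarrow>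
     (\<forall>t::real. \<forall>X. E (evol (ham_sum HR HS) t X) = evol (ham_sum HR HS) t (E X))"

end

theory Submission
  imports Defs "HOL-Library.Complex_Order"
begin

text \<open>Write ad H X = [H, X]. Differentiating covariance at t = 0 gives E (ad H X) = ad H (E X) for the
total Hamiltonian. Let T be the Heisenberg dual of X \<mapsto> E (X \<otimes> \<rho>S) and \<Theta> A = T (A \<otimes> 1), so \<rho>R is a
fixed point of the predual of \<Theta>, and so are all (ad H)^k \<rho>R. After a modification of T off the smallest
H-invariant subspace containing the range of \<rho>R these fixed functionals separate the positive operators;
hence the fixed points D of \<Theta> form a *-algebra in the multiplicative domain of T, and C = T (1 \<otimes> B) lies
in its commutant, which \<Theta> preserves. If Y commutes with all fixed points and
K = [H, Y] is itself fixed, then tr (K* [H, Y]) = tr (K* H Y) - tr (K* Y H) = 0 because K* is fixed too,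
so K = 0. Thus \<Theta> - 1 is injective, hence surjective, on the image of the commutant under ad H, so
[H, C] = \<Theta> Y - Y for some Y and tr (\<rho>R [H, C]) = 0. For all B this says [\<rho>S', HS] = 0. In effect,
R can only broadcast what lies in the centre of the fixed-point algebra, where time evolution is trivial.\<close>

lemma nonneg_iff: "0 \<le> (z::complex) \<longleftrightarrow> Im z = 0 \<and> Re z \<ge> 0"
  by (auto simp: less_eq_complex_def)

lemma cnj_mult_self_nonneg: "0 \<le> cnj z * (z::complex)"
  by (simp add: nonneg_iff algebra_simps)

section \<open>Matrix algebra\<close>

lemma op_sub_ldistrib: "(A::'n::finite op) ** (B - C) = A ** B - A ** C"
  by (simp add: matrix_matrix_mult_def vec_eq_iff sum_subtractf algebra_simps)

lemma op_add_rdistrib: "((B::'n::finite op) + C) ** A = B ** A + C ** A"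
  by (simp add: matrix_matrix_mult_def vec_eq_iff sum.distrib algebra_simps)

lemma op_sub_rdistrib: "((B::'n::finite op) - C) ** A = B ** A - C ** A"
  by (simp add: matrix_matrix_mult_def vec_eq_iff sum_subtractf algebra_simps)

lemma op_minus_left [simp]: "(- A :: 'n::finite op) ** B = - (A ** B)"
  by (simp add: matrix_matrix_mult_def vec_eq_iff sum_negf)

lemma op_minus_right [simp]: "(A :: 'n::finite op) ** (- B) = - (A ** B)"
  by (simp add: matrix_matrix_mult_def vec_eq_iff sum_negf)

lemma op_scaleR_left: "(r *\<^sub>R A :: 'n::finite op) ** B = r *\<^sub>R (A ** B)"
  by (simp add: matrix_matrix_mult_def vec_eq_iff scaleR_right.sum)

lemma op_scaleR_right: "(A :: 'n::finite op) ** (r *\<^sub>R B) = r *\<^sub>R (A ** B)"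
  by (simp add: matrix_matrix_mult_def vec_eq_iff scaleR_right.sum)

lemma smat_nth [simp]: "smat c A $ i $ j = c * A $ i $ j"
  by (simp add: smat_def)

lemma smat_mult_left [simp]: "smat c A ** B = smat c (A ** B)"
  by (simp add: matrix_matrix_mult_def vec_eq_iff sum_distrib_left mult.assoc)

lemma smat_mult_right [simp]: "A ** smat c B = smat c (A ** B)"
  by (simp add: matrix_matrix_mult_def vec_eq_iff sum_distrib_left mult.left_commute)

lemmas op_distribs = matrix_add_ldistrib op_add_rdistrib op_sub_ldistrib op_sub_rdistrib

lemma trace_smat [simp]: "trace (smat c A) = c * trace A"
  by (simp add: trace_def sum_distrib_left)

lemma trace_neg: "trace (- A :: 'n::finite op) = - trace A"
  by (simp add: trace_def sum_negf)

lemma trace_zero [simp]: "trace (0 :: 'n::finite op) = 0"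
  by (simp add: trace_def)

lemma trace_cycle: "trace (A ** B ** C) = trace (B ** C ** (A :: 'n::finite op))"
  by (metis matrix_mul_assoc trace_mul_sym)

lemma adj_nth [simp]: "adj A $ i $ j = cnj (A $ j $ i)"
  by (simp add: adj_def)

lemma adj_adj [simp]: "adj (adj A) = A"
  by (simp add: vec_eq_iff)

lemma adj_mult: "adj (A ** B) = adj B ** adj A"
  by (simp add: matrix_matrix_mult_def vec_eq_iff mult.commute)

lemma adj_add: "adj (A + B) = adj A + adj B"
  by (simp add: vec_eq_iff)

lemma adj_diff: "adj (A - B) = adj A - adj B"
  by (simp add: vec_eq_iff)

lemma adj_smat: "adj (smat c A) = smat (cnj c) (adj A)"
  by (simp add: vec_eq_iff)

lemma adj_minus: "adj (- A) = - adj A"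
  by (simp add: vec_eq_iff)

lemma adj_mat_1 [simp]: "adj (mat 1) = mat 1"
  by (simp add: vec_eq_iff mat_def)

lemma adj_0 [simp]: "adj 0 = 0"
  by (simp add: vec_eq_iff)

lemma trace_adj: "trace (adj A) = cnj (trace A)"
  by (simp add: trace_def)

lemma trace_adj_mult: "trace (adj A ** B) = (\<Sum>i\<in>UNIV. \<Sum>j\<in>UNIV. cnj (A $ i $ j) * B $ i $ j)"
  unfolding trace_def matrix_matrix_mult_def by (simp, subst sum.swap, rule refl)

lemma trace_adj_self_nonneg: "0 \<le> trace (adj A ** A)"
  unfolding trace_adj_mult by (intro sum_nonneg cnj_mult_self_nonneg)

lemma trace_adj_self_zero:
  assumes "trace (adj A ** A) = 0" shows "A = 0"
proof -
  have "\<forall>i\<in>UNIV. (\<Sum>j\<in>UNIV. cnj (A $ i $ j) * A $ i $ j) = 0"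
    using assms unfolding trace_adj_mult
    by (subst (asm) sum_nonneg_eq_0_iff) (auto intro!: sum_nonneg cnj_mult_self_nonneg)
  then have "\<forall>i. \<forall>j\<in>UNIV. cnj (A $ i $ j) * A $ i $ j = 0"
    by (subst (asm) sum_nonneg_eq_0_iff) (auto intro!: cnj_mult_self_nonneg)
  then show ?thesis by (simp add: vec_eq_iff)
qed

text \<open>The witness is \<open>W = adj A\<close>. This nondegeneracy of the trace pairing is what
  carries identities between states and observables below.\<close>

lemma trace_mult_zero_imp_zero:
  fixes A :: "'n::finite op"
  assumes "\<And>W. trace (W ** A) = 0" shows "A = 0"
  by (rule trace_adj_self_zero) (rule assms)

lemma trace_mult_eqI:
  assumes "\<And>W. trace (W ** A) = trace (W ** (B :: 'n::finite op))" shows "A = B"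
proof -
  have "A - B = 0"
    by (rule trace_mult_zero_imp_zero) (simp add: op_sub_ldistrib trace_sub assms)
  then show ?thesis by simp
qed

section \<open>Tensor products and partial traces\<close>

lemma kron_nth [simp]: "kron A B $ (i,k) $ (j,l) = A $ i $ j * B $ k $ l"
  by (simp add: kron_def)

lemma sum_UNIV_Times:
  "(\<Sum>p\<in>(UNIV::('a::finite \<times> 'b::finite) set). f p) = (\<Sum>i\<in>UNIV. \<Sum>k\<in>UNIV. f (i,k))"
  by (simp add: sum.cartesian_product UNIV_Times_UNIV[symmetric] del: UNIV_Times_UNIV)

lemma kron_mult: "kron A B ** kron C D = kron (A ** C) (B ** D)"
  by (simp add: vec_eq_iff matrix_matrix_mult_def sum_UNIV_Times sum_product mult_ac)

lemma kron_adj: "adj (kron A B) = kron (adj A) (adj B)"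
  by (simp add: vec_eq_iff)

lemma kron_add_left: "kron (A + A') B = kron A B + kron A' B"
  by (simp add: vec_eq_iff algebra_simps)

lemma kron_diff_left: "kron (A - A') B = kron A B - kron A' B"
  by (simp add: vec_eq_iff algebra_simps)

lemma kron_smat_left: "kron (smat c A) B = smat c (kron A B)"
  by (simp add: vec_eq_iff algebra_simps)

lemma kron_zero_left [simp]: "kron 0 B = 0"
  by (simp add: vec_eq_iff)

lemma trace_kron: "trace (kron A B) = trace A * trace B"
  by (simp add: trace_def sum_UNIV_Times sum_product)

lemma ptrace_2_nth [simp]: "ptrace_2 X $ i $ j = (\<Sum>k\<in>UNIV. X $ (i,k) $ (j,k))"
  by (simp add: ptrace_2_def)

lemma ptrace_1_nth [simp]: "ptrace_1 X $ k $ l = (\<Sum>i\<in>UNIV. X $ (i,k) $ (i,l))"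
  by (simp add: ptrace_1_def)

text \<open>Duality between partial trace and tensoring with the identity: marginals are determined
  by testing the joint operator on local observables.\<close>

lemma trace_kron_1_right: "trace (X ** kron A (mat 1)) = trace (ptrace_2 X ** A)"
proof -
  have "trace (X ** kron A (mat 1)) =
      (\<Sum>i\<in>UNIV. \<Sum>k\<in>UNIV. \<Sum>j\<in>UNIV. X $ (i,k) $ (j,k) * A $ j $ i)"
    by (simp add: trace_def matrix_matrix_mult_def sum_UNIV_Times mat_def if_distrib
        cong: if_cong)
  also have "\<dots> = trace (ptrace_2 X ** A)"
    unfolding trace_def matrix_matrix_mult_def
    by (simp add: sum_distrib_right, intro sum.cong refl, rule sum.swap)
  finally show ?thesis .
qed

lemma trace_kron_1_left: "trace (X ** kron (mat 1) B) = trace (ptrace_1 X ** B)"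
proof -
  have "trace (X ** kron (mat 1) B) =
      (\<Sum>i\<in>UNIV. \<Sum>k\<in>UNIV. \<Sum>l\<in>UNIV. X $ (i,k) $ (i,l) * B $ l $ k)"
    by (simp add: trace_def matrix_matrix_mult_def sum_UNIV_Times mat_def if_distrib if_distribR
        cong: if_cong) (intro sum.cong refl, subst sum.swap, simp)
  also have "\<dots> = (\<Sum>k\<in>UNIV. \<Sum>i\<in>UNIV. \<Sum>l\<in>UNIV. X $ (i,k) $ (i,l) * B $ l $ k)"
    by (rule sum.swap)
  also have "\<dots> = trace (ptrace_1 X ** B)"
    unfolding trace_def matrix_matrix_mult_def
    by (simp add: sum_distrib_right, intro sum.cong refl, rule sum.swap)
  finally show ?thesis .
qed

lemma ptrace_2_kron: "ptrace_2 (kron A B) = smat (trace B) A"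
  by (simp add: vec_eq_iff trace_def sum_distrib_left[symmetric] mult.commute)

lemma ptrace_2_add: "ptrace_2 (X + Y) = ptrace_2 X + ptrace_2 Y"
  by (simp add: vec_eq_iff sum.distrib)

section \<open>Positive semidefinite matrices are Gram matrices\<close>

text \<open>Reality at \<open>c = 1\<close> and \<open>c = \<i>\<close> relates the two linear
  coefficients. If the constant term vanishes, a nonzero linear term would dominate the quadratic
  one for small \<open>c\<close> and make the value negative.\<close>

lemma nonneg_quadratic:
  fixes \<alpha> \<beta> z z' :: complex
  assumes pos: "\<And>c. 0 \<le> \<alpha> + c * z + cnj c * z' + c * cnj c * \<beta>" and "0 \<le> \<beta>"
  shows "z' = cnj z" and "\<alpha> = 0 \<Longrightarrow> z = 0"
proof -
  have \<alpha>: "0 \<le> \<alpha>" using pos[of 0] by simp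
  show z': "z' = cnj z"
    using pos[of 1] pos[of \<i>] \<alpha> \<open>0 \<le> \<beta>\<close> by (simp add: nonneg_iff complex_eq_iff)
  show "z = 0" if "\<alpha> = 0"
  proof (rule ccontr)
    assume "z \<noteq> 0"
    define b where "b = Re \<beta>"
    have b: "b \<ge> 0" "\<beta> = of_real b" using \<open>0 \<le> \<beta>\<close> by (auto simp: b_def nonneg_iff complex_eq_iff)
    define n where "n = (norm z)\<^sup>2"
    have n: "n > 0" using \<open>z \<noteq> 0\<close> by (simp add: n_def)
    have zz: "z * cnj z = of_real n" unfolding n_def by (simp only: complex_norm_square)
    \<comment> \<open>At \<open>c = - s * cnj z\<close> the form equals
      \<open>s * n * (s * b - 2)\<close>, and this \<open>s\<close> keeps \<open>s * b\<close> below
      1 even when \<open>b = 0\<close>.\<close>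
    define s where "s = 1 / (b + 1)"
    have "0 \<le> \<alpha> + (- of_real s * cnj z) * z + cnj (- of_real s * cnj z) * z' +
        (- of_real s * cnj z) * cnj (- of_real s * cnj z) * \<beta>" by (rule pos)
    also have "\<dots> = of_real (- s * n - s * n + s * s * n * b)"
    proof -
      have "(- of_real s * cnj z) * z = of_real (- s * n)"
        using zz by (simp add: mult.commute)
      moreover have "cnj (- of_real s * cnj z) * z' = of_real (- s * n)"
        using zz by (simp add: z')
      moreover have "(- of_real s * cnj z) * cnj (- of_real s * cnj z) * \<beta> = of_real (s * s * n * b)"
        using zz by (simp add: b mult_ac)
      ultimately show ?thesis by (simp only: that) simp
    qed
    finally have "0 \<le> - s * n - s * n + s * s * n * b" by (simp add: nonneg_iff)
    also have "\<dots> = s * n * (s * b - 2)" by (simp add: algebra_simps)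
    finally have "0 \<le> s * n * (s * b - 2)" .
    moreover have "s > 0" "s * b < 2" using b by (auto simp: s_def field_simps)
    ultimately show False using n by (smt (verit) mult_pos_pos mult_pos_neg)
  qed
qed

lemma psd_iff: "psd A \<longleftrightarrow> (\<forall>v. 0 \<le> quad_form A v)"
  by (simp add: psd_def nonneg_iff)

lemma quad_form_add_axis:
  "quad_form A (v + axis i c) = quad_form A v + c * (\<Sum>j\<in>UNIV. cnj (v $ j) * A $ j $ i)
     + cnj c * (\<Sum>j\<in>UNIV. A $ i $ j * v $ j) + c * cnj c * A $ i $ i"
proof -
  have eq: "cnj ((v + axis i c) $ k) * A $ k $ j * (v + axis i c) $ j =
      cnj (v $ k) * A $ k $ j * v $ j
      + (if j = i then c * (cnj (v $ k) * A $ k $ j) else 0)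
      + (if k = i then cnj c * (A $ k $ j * v $ j) else 0)
      + (if k = i then if j = i then c * cnj c * A $ i $ i else 0 else 0)" for k j
    by (auto simp: axis_def algebra_simps)
  have swap: "(\<Sum>k\<in>UNIV. \<Sum>j\<in>UNIV. if k = i then f k j else 0) = (\<Sum>j\<in>UNIV. f i j)"
    for f :: "'a \<Rightarrow> 'a \<Rightarrow> complex"
    by (subst sum.swap) simp
  show ?thesis
    unfolding quad_form_def eq sum.distrib swap by (simp add: sum_distrib_left)
qed

lemma quad_form_axis: "quad_form A (axis i c) = cnj c * A $ i $ i * c"
  using quad_form_add_axis[of A 0 i c] by (simp add: quad_form_def mult_ac)

lemma psd_diag: "psd A \<Longrightarrow> 0 \<le> A $ i $ i"
  using quad_form_axis[of A i 1] by (metis complex_cnj_one mult_1 mult.right_neutral psd_iff)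

lemma psd_quadratic:
  assumes "psd A"
  shows "0 \<le> quad_form A v + c * (\<Sum>j\<in>UNIV. cnj (v $ j) * A $ j $ i)
     + cnj c * (\<Sum>j\<in>UNIV. A $ i $ j * v $ j) + c * cnj c * A $ i $ i"
  using assms unfolding psd_iff quad_form_add_axis[symmetric] by blast

lemma psd_row:
  assumes "psd A"
  shows "(\<Sum>j\<in>UNIV. A $ i $ j * v $ j) = cnj (\<Sum>j\<in>UNIV. cnj (v $ j) * A $ j $ i)"
  by (rule nonneg_quadratic(1)[OF psd_quadratic[OF assms] psd_diag[OF assms]])

text \<open>Hermiticity is not built into \<open>psd\<close>; it follows from the reality of the
  quadratic form, by applying \<open>psd_row\<close> to a basis vector.\<close>

lemma psd_adj:
  assumes "psd A"
  shows "A $ j $ i = cnj (A $ i $ j)"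
  using psd_row[OF assms, of j "axis i 1"] by (simp add: axis_def if_distrib if_distribR cong: if_cong)

lemma psd_diag_zero:
  assumes "psd A" and "A $ i $ i = 0"
  shows "A $ i $ j = 0"
proof -
  have "(\<Sum>k\<in>UNIV. cnj (axis i 1 $ k) * A $ k $ j) = 0"
    by (rule nonneg_quadratic(2)[OF psd_quadratic[OF assms(1)] psd_diag[OF assms(1)]])
      (simp add: quad_form_axis assms)
  then show ?thesis by (simp add: axis_def if_distrib if_distribR cong: if_cong)
qed

text \<open>One step of the Cholesky decomposition: completing the square in the coordinate i.\<close>

lemma psd_schur_complement:
  assumes A: "psd A" and i: "A $ i $ i \<noteq> 0"
  shows "psd (\<chi> j k. A $ j $ k - A $ j $ i * A $ i $ k / A $ i $ i)" (is "psd ?B")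
  unfolding psd_iff
proof
  fix v :: "complex^'a"
  define s where "s = (\<Sum>j\<in>UNIV. A $ i $ j * v $ j)"
  \<comment> \<open>The minimiser over \<open>c\<close> of the quadratic form at
    \<open>v + axis i c\<close>; the minimum is the form of the Schur complement at
    \<open>v\<close>.\<close>
  define c where "c = - s / A $ i $ i"
  have cs: "(\<Sum>j\<in>UNIV. cnj (v $ j) * A $ j $ i) = cnj s"
    unfolding s_def psd_row[OF A] by simp
  have real: "cnj (A $ i $ i) = A $ i $ i" using psd_adj[OF A, of i i] by simp
  have "0 \<le> quad_form A v + c * cnj s + cnj c * s + c * cnj c * A $ i $ i"
    using psd_quadratic[OF A, of v c i] by (simp add: cs s_def)
  also have "\<dots> = quad_form A v - s * cnj s / A $ i $ i"
    using i by (simp add: c_def real field_simps)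
  also have "s * cnj s / A $ i $ i = (\<Sum>j\<in>UNIV. \<Sum>k\<in>UNIV. (cnj (v $ j) * A $ j $ i) * (A $ i $ k * v $ k) / A $ i $ i)"
    unfolding sum_divide_distrib[symmetric] sum_product[symmetric] cs s_def[symmetric] by simp
  also have "quad_form A v - \<dots> = quad_form ?B v"
    by (simp add: quad_form_def sum_subtractf[symmetric] algebra_simps)
  finally show "0 \<le> quad_form ?B v" .
qed

text \<open>Induction on the number of nonzero diagonal entries, each Schur complement clearing at
  least one. The clause on zero columns of \<open>R\<close> keeps column \<open>i\<close> free for
  the rank-one term that was split off.\<close>

lemma psd_gram_aux:
  fixes A :: "'n::finite op"
  assumes "psd A"
  shows "\<exists>R. A = R ** adj R \<and> (\<forall>i j. A $ j $ j = 0 \<longrightarrow> R $ i $ j = 0)"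
  using assms
proof (induction "card {i. A $ i $ i \<noteq> 0}" arbitrary: A rule: less_induct)
  case less
  show ?case
  proof (cases "\<forall>i. A $ i $ i = 0")
    case True
    then have "A = 0" using psd_diag_zero[OF less.prems] by (simp add: vec_eq_iff)
    then show ?thesis by (intro exI[of _ 0]) simp
  next
    case False
    then obtain i where i: "A $ i $ i \<noteq> 0" by blast
    define B :: "'n op" where "B = (\<chi> j k. A $ j $ k - A $ j $ i * A $ i $ k / A $ i $ i)"
    have B: "psd B" unfolding B_def by (rule psd_schur_complement[OF less.prems i])
    have Bi: "B $ i $ i = 0" using i by (simp add: B_def)
    have zero: "B $ j $ j = 0" if "A $ j $ j = 0" for j
      using psd_diag_zero[OF less.prems that] by (simp add: B_def that)
    have "{j. B $ j $ j \<noteq> 0} \<subset> {j. A $ j $ j \<noteq> 0}"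
      using i Bi zero by blast
    then have "card {j. B $ j $ j \<noteq> 0} < card {j. A $ j $ j \<noteq> 0}"
      by (intro psubset_card_mono) auto
    from less.hyps[OF this B] obtain R where
      R: "B = R ** adj R" "\<And>k j. B $ j $ j = 0 \<Longrightarrow> R $ k $ j = 0" by blast
    define r where "r = sqrt (Re (A $ i $ i))"
    have r: "complex_of_real r * complex_of_real r = A $ i $ i"
      using psd_diag[OF less.prems, of i] by (simp add: r_def nonneg_iff complex_eq_iff)
    define R' :: "'n op" where "R' = (\<chi> k j. if j = i then A $ k $ i / of_real r else R $ k $ j)"
    have "A = R' ** adj R'"
    proof (simp add: vec_eq_iff, intro allI)
      fix k l
      have "(R' ** adj R') $ k $ l = (\<Sum>j\<in>UNIV. R $ k $ j * cnj (R $ l $ j) +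
          (if j = i then A $ k $ i * cnj (A $ l $ i) / A $ i $ i else 0))"
        unfolding matrix_matrix_mult_def R'_def
        by (auto intro!: sum.cong simp: R(2)[OF Bi] r[symmetric])
      also have "\<dots> = (R ** adj R) $ k $ l + A $ k $ i * A $ i $ l / A $ i $ i"
        by (simp add: sum.distrib matrix_matrix_mult_def psd_adj[OF less.prems, of i l])
      also have "\<dots> = A $ k $ l" unfolding R(1)[symmetric] by (simp add: B_def)
      finally show "A $ k $ l = (R' ** adj R') $ k $ l" by simp
    qed
    moreover have "\<forall>k j. A $ j $ j = 0 \<longrightarrow> R' $ k $ j = 0"
      using i zero R(2) by (auto simp: R'_def)
    ultimately show ?thesis by blast
  qed
qed

lemma psd_gram:
  fixes A :: "'n::finite op"
  assumes "psd A"
  obtains R where "A = R ** adj R"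
  using psd_gram_aux[OF assms] by blast

section \<open>Infinitesimal covariance\<close>

lemma mpow_0 [simp]: "mpow A 0 = mat 1"
  by (simp add: mpow_def)

lemma mpow_Suc: "mpow A (Suc k) = A ** mpow A k"
  by (simp add: mpow_def)

lemma mpow_smat: "mpow (smat c A) k = smat (c ^ k) (mpow A k)"
proof (induction k)
  case (Suc k)
  show ?case unfolding mpow_Suc Suc by (simp add: vec_eq_iff mult_ac)
qed (simp add: vec_eq_iff)

text \<open>The sum of all entry norms serves as a crude submultiplicative bound, enough to dominate
  the exponential series.\<close>

lemma norm_mpow_le: "norm (mpow A k $ i $ j) \<le> (\<Sum>i\<in>UNIV. \<Sum>j\<in>UNIV. norm (A $ i $ j)) ^ k"
proof (induction k arbitrary: i j)
  case 0
  show ?case by (simp add: mat_def)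
next
  case (Suc k)
  define b where "b = (\<Sum>i\<in>UNIV. \<Sum>j\<in>UNIV. norm (A $ i $ j))"
  have "norm (mpow A (Suc k) $ i $ j) \<le> (\<Sum>l\<in>UNIV. norm (A $ i $ l) * b ^ k)"
    unfolding mpow_Suc matrix_matrix_mult_def
    by (simp, rule sum_norm_le) (simp add: norm_mult mult_left_mono Suc b_def)
  also have "\<dots> = (\<Sum>l\<in>UNIV. norm (A $ i $ l)) * b ^ k"
    by (simp add: sum_distrib_right)
  also have "\<dots> \<le> b * b ^ k"
  proof (rule mult_right_mono)
    show "(\<Sum>l\<in>UNIV. norm (A $ i $ l)) \<le> b"
      unfolding b_def by (rule member_le_sum) (auto intro: sum_nonneg)
    show "0 \<le> b ^ k" unfolding b_def by (intro zero_le_power sum_nonneg) auto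
  qed
  finally show ?case by (simp add: b_def)
qed

lemma summable_mpow:
  "summable (\<lambda>k. mpow A k $ i $ j / of_nat (fact k) * (z::complex) ^ k)"
proof (rule summable_comparison_test')
  define b where "b = (\<Sum>i\<in>UNIV. \<Sum>j\<in>UNIV. norm (A $ i $ j))"
  show "summable (\<lambda>k. inverse (fact k) * (b * norm z) ^ k)"
    by (rule summable_exp)
  fix k :: nat
  have "norm (mpow A k $ i $ j) * norm z ^ k \<le> b ^ k * norm z ^ k"
    unfolding b_def by (intro mult_right_mono norm_mpow_le) auto
  then show "norm (mpow A k $ i $ j / of_nat (fact k) * z ^ k) \<le> inverse (fact k) * (b * norm z) ^ k"
    by (simp add: norm_mult norm_divide norm_power power_mult_distrib divide_simps)
qed

lemma mexp_smat_nth: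
  "mexp (smat z A) $ i $ j = (\<Sum>k. mpow A k $ i $ j / of_nat (fact k) * z ^ k)"
  by (simp add: mexp_def mpow_smat mult_ac)

lemma mexp_smat_0: "mexp (smat 0 A) = mat 1"
  unfolding vec_eq_iff mexp_smat_nth powser_zero by simp

text \<open>Each entry is an everywhere convergent power series in \<open>z\<close>, so the
  derivative at 0 is its linear coefficient.\<close>

lemma mexp_nth_derivative_0:
  "((\<lambda>z. mexp (smat z A) $ i $ j) has_field_derivative A $ i $ j) (at 0)"
proof -
  have "((\<lambda>z. mexp (smat z A) $ i $ j) has_field_derivative
      (\<Sum>k. diffs (\<lambda>k. mpow A k $ i $ j / of_nat (fact k)) k * 0 ^ k)) (at 0)"
    unfolding mexp_smat_nth
    by (rule termdiffs_strong_converges_everywhere) (rule summable_mpow)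
  then show ?thesis
    unfolding powser_zero by (simp add: diffs_def mpow_Suc)
qed

lemma has_vector_derivative_vecI:
  fixes f :: "real \<Rightarrow> ('a::real_normed_vector)^'n::finite"
  assumes "\<And>i. ((\<lambda>t. f t $ i) has_vector_derivative f' $ i) (at x)"
  shows "(f has_vector_derivative f') (at x)"
  unfolding has_vector_derivative_def has_derivative_at
proof
  show "bounded_linear (\<lambda>t. t *\<^sub>R f')" by (rule bounded_linear_scaleR_left)
  have "((\<lambda>h. (norm (f (x + h) - f x - h *\<^sub>R f') / norm h)) \<longlongrightarrow> 0) (at 0) \<longleftrightarrow>
        ((\<lambda>h. (f (x + h) - f x - h *\<^sub>R f') /\<^sub>R norm h) \<longlongrightarrow> 0) (at 0)"
    by (subst tendsto_norm_zero_iff[symmetric]) (simp add: divide_inverse mult.commute)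
  moreover have "((\<lambda>h. (f (x + h) - f x - h *\<^sub>R f') /\<^sub>R norm h) \<longlongrightarrow> 0) (at 0)"
  proof (rule vec_tendstoI)
    fix i
    have "((\<lambda>h. norm (f (x + h) $ i - f x $ i - h *\<^sub>R f' $ i) / norm h) \<longlongrightarrow> 0) (at 0)"
      using assms[of i] unfolding has_vector_derivative_def has_derivative_at by blast
    then have "((\<lambda>h. norm ((f (x + h) $ i - f x $ i - h *\<^sub>R f' $ i) /\<^sub>R norm h)) \<longlongrightarrow> 0) (at 0)"
      by (simp add: divide_inverse mult.commute)
    from tendsto_norm_zero_cancel[OF this]
    show "((\<lambda>h. ((f (x + h) - f x - h *\<^sub>R f') /\<^sub>R norm h) $ i) \<longlongrightarrow> 0 $ i) (at 0)"
      by simp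
  qed
  ultimately show "((\<lambda>h. norm (f (x + h) - f x - h *\<^sub>R f') / norm h) \<longlongrightarrow> 0) (at 0)"
    by blast
qed

lemma mexp_derivative_0:
  "((\<lambda>t. mexp (smat (c * of_real t) A)) has_vector_derivative smat c A) (at 0)"
proof (intro has_vector_derivative_vecI)
  fix i j
  have "((\<lambda>t. c * complex_of_real t) has_vector_derivative c) (at 0)"
    by (auto intro!: derivative_eq_intros)
  then have "(((\<lambda>z. mexp (smat z A) $ i $ j) \<circ> (\<lambda>t. c * complex_of_real t))
      has_vector_derivative c * A $ i $ j) (at 0)"
    by (rule field_vector_diff_chain_at) (simp add: mexp_nth_derivative_0)
  then show "((\<lambda>t. mexp (smat (c * complex_of_real t) A) $ i $ j)
      has_vector_derivative smat c A $ i $ j) (at 0)"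
    by (simp add: o_def)
qed

lemma bounded_bilinear_op_mult: "bounded_bilinear ((**) :: 'n::finite op \<Rightarrow> 'n op \<Rightarrow> 'n op)"
  unfolding bilinear_conv_bounded_bilinear[symmetric] bilinear_def
  by (auto intro!: linearI simp: op_distribs op_scaleR_left op_scaleR_right)

section \<open>Commutators as generators of the time evolution\<close>

definition ad :: "'n::finite op \<Rightarrow> 'n op \<Rightarrow> 'n op" where
  "ad H X = H ** X - X ** H"

lemma linear_ad: "linear (ad H)"
  by (intro linearI) (simp_all add: ad_def op_distribs op_scaleR_left op_scaleR_right algebra_simps)

lemma linear_ad_funpow: "linear (ad H ^^ k)"
proof (induction k)
  case 0
  show ?case by (simp only: funpow.simps linear_id)
next
  case (Suc k)
  show ?case unfolding funpow.simps by (rule linear_compose[OF Suc linear_ad])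
qed

lemma evol_derivative_0:
  "((\<lambda>t. evol H t Z) has_vector_derivative smat (- \<i>) (ad H Z)) (at 0)"
proof -
  have *: "((\<lambda>t. mexp (smat (- \<i> * of_real t) H) ** Z) has_vector_derivative
      (mat 1 ** 0 + smat (- \<i>) H ** Z)) (at 0)"
    using bounded_bilinear.has_vector_derivative[OF bounded_bilinear_op_mult
        mexp_derivative_0[of "- \<i>" H] has_vector_derivative_const[of Z]]
    by (simp add: mexp_smat_0)
  have "((\<lambda>t. evol H t Z) has_vector_derivative
      (mat 1 ** Z ** smat \<i> H + (mat 1 ** 0 + smat (- \<i>) H ** Z) ** mat 1)) (at 0)"
    unfolding evol_def
    using bounded_bilinear.has_vector_derivative[OF bounded_bilinear_op_mult
        * mexp_derivative_0[of \<i> H]] by (simp add: mexp_smat_0)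
  also have "mat 1 ** Z ** smat \<i> H + (mat 1 ** 0 + smat (- \<i>) H ** Z) ** mat 1 = smat (- \<i>) (ad H Z)"
    by (simp add: ad_def vec_eq_iff algebra_simps)
  finally show ?thesis .
qed

lemma smat_of_real: "smat (complex_of_real r) X = r *\<^sub>R X"
  by (simp add: vec_eq_iff scaleR_conv_of_real[where 'a = complex])

lemma clinear_bounded_linear:
  assumes "clinear_map E"
  shows "bounded_linear E"
  unfolding linear_conv_bounded_linear[symmetric]
  using assms unfolding clinear_map_def by (intro linearI) (simp_all flip: smat_of_real)

text \<open>Both sides of the covariance identity are differentiated at \<open>t = 0\<close>; a
  linear map in finite dimension is bounded and passes through the derivative.\<close>

lemma covariant_ad:
  assumes "clinear_map E" and cov: "\<And>t X. E (evol H t X) = evol H' t (E X)"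
  shows "E (ad H Z) = ad H' (E Z)"
proof -
  have "((\<lambda>t. E (evol H t Z)) has_vector_derivative E (smat (- \<i>) (ad H Z))) (at 0)"
    by (rule bounded_linear.has_vector_derivative[OF clinear_bounded_linear[OF assms(1)] evol_derivative_0])
  moreover have "((\<lambda>t. E (evol H t Z)) has_vector_derivative smat (- \<i>) (ad H' (E Z))) (at 0)"
    unfolding cov by (rule evol_derivative_0)
  ultimately have "E (smat (- \<i>) (ad H Z)) = smat (- \<i>) (ad H' (E Z))"
    by (rule vector_derivative_unique_at)
  then have "smat (- \<i>) (E (ad H Z)) = smat (- \<i>) (ad H' (E Z))"
    using assms(1) unfolding clinear_map_def by metis
  then show ?thesis by (simp add: vec_eq_iff)
qed

section \<open>Projections onto right ideals\<close>

lemma inner_op: "A \<bullet> (B :: 'n::finite op) = Re (trace (adj A ** B))"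
  by (simp add: inner_vec_def trace_adj_mult inner_complex_def)

text \<open>\<open>Q\<close> is the Hilbert-Schmidt projection of the identity onto
  \<open>S\<close>. Its complement \<open>A\<close> satisfies \<open>adj A ** M = 0\<close> on
  \<open>S\<close>, so \<open>adj Q\<close> is a left unit there; applied to \<open>Q\<close> itself
  this gives self-adjointness and idempotence.\<close>

lemma right_ideal_projection:
  fixes S :: "'n::finite op set"
  assumes "subspace S" and ideal: "\<And>M N. M \<in> S \<Longrightarrow> M ** N \<in> S"
  obtains Q where "Q \<in> S" "adj Q = Q" "Q ** Q = Q" "\<And>M. M \<in> S \<Longrightarrow> Q ** M = M"
proof -
  have span: "span S = S" using assms(1) by (simp add: span_eq_iff)
  obtain Q A where Q: "Q \<in> S" and orth: "\<And>M. M \<in> S \<Longrightarrow> orthogonal A M" and sum: "mat 1 = Q + A"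
    using orthogonal_subspace_decomp_exists[of S "mat 1"] unfolding span by metis
  have zero: "adj A ** M = 0" if "M \<in> S" for M
  proof -
    \<comment> \<open>The ideal property keeps \<open>M ** adj (adj A ** M)\<close> in
      \<open>S\<close>, and orthogonality to it makes the Hilbert-Schmidt norm of
      \<open>adj A ** M\<close> vanish.\<close>
    have "Re (trace (adj A ** (M ** adj (adj A ** M)))) = 0"
      using orth[OF ideal[OF that]] by (simp add: orthogonal_def inner_op)
    then have "Re (trace (adj (adj A ** M) ** (adj A ** M))) = 0"
      by (subst trace_mul_sym) (simp add: matrix_mul_assoc)
    then have "trace (adj (adj A ** M) ** (adj A ** M)) = 0"
      using trace_adj_self_nonneg[of "adj A ** M"] by (simp add: nonneg_iff complex_eq_iff)
    then show ?thesis by (rule trace_adj_self_zero)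
  qed
  have A: "A = mat 1 - Q" using sum by simp
  have fixQ: "M = adj Q ** M" if "M \<in> S" for M
    using zero[OF that] by (simp add: A adj_diff op_sub_rdistrib)
  have herm: "adj Q = Q"
    by (metis fixQ[OF Q] adj_mult adj_adj)
  show ?thesis
    using Q fixQ herm by (intro that[of Q]) auto
qed

section \<open>Positive forms vanishing on the orbit of a state\<close>

text \<open>A null vector of a positive form is orthogonal to every vector, by
  \<open>nonneg_quadratic\<close> along \<open>V + smat c (adj W)\<close>.\<close>

lemma psd_form_zero:
  fixes G :: "'n::finite op"
  assumes G: "\<And>V. 0 \<le> trace (adj V ** G ** V)" and zero: "trace (adj V ** G ** V) = 0"
  shows "G ** V = 0"
proof (rule trace_mult_zero_imp_zero)
  fix W
  define z where "z = trace (adj V ** G ** adj W)"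
  define z' where "z' = trace (W ** G ** V)"
  have *: "0 \<le> trace (adj V ** G ** V) + c * z + cnj c * z' + c * cnj c * trace (adj (adj W) ** G ** adj W)" for c
    using G[of "V + smat c (adj W)"]
    by (simp add: adj_add adj_smat op_distribs trace_add z_def z'_def algebra_simps)
  have "z' = cnj z" "z = 0"
    using nonneg_quadratic[OF * G] zero by auto
  then show "trace (W ** (G ** V)) = 0" by (simp add: z'_def matrix_mul_assoc)
qed

text \<open>With \<open>\<rho> = R ** adj R\<close> the trace is the form of \<open>G\<close> at
  \<open>K ** R\<close>, so \<open>psd_form_zero\<close> applies.\<close>

lemma psd_trace_zero:
  fixes G :: "'n::finite op"
  assumes G: "\<And>V. 0 \<le> trace (adj V ** G ** V)" and "psd \<rho>"
    and zero: "trace (adj K ** G ** K ** \<rho>) = 0"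
  shows "G ** K ** \<rho> = 0"
proof -
  obtain R where R: "\<rho> = R ** adj R" using psd_gram[OF assms(2)] .
  have "trace (adj (K ** R) ** G ** (K ** R)) = trace (adj K ** G ** K ** \<rho>)"
    unfolding R adj_mult by (simp only: matrix_mul_assoc[symmetric], subst trace_mul_sym)
      (simp only: matrix_mul_assoc)
  then have "G ** (K ** R) = 0" by (intro psd_form_zero G) (simp add: zero)
  moreover have "G ** K ** \<rho> = G ** (K ** R) ** adj R" by (simp only: R matrix_mul_assoc)
  ultimately show ?thesis by simp
qed

lemma mpow_Suc_right: "mpow A (Suc k) = mpow A k ** A"
proof (induction k)
  case (Suc k)
  have "mpow A (Suc (Suc k)) = A ** (mpow A k ** A)" by (simp only: mpow_Suc[of A "Suc k"] Suc)
  also have "\<dots> = mpow A (Suc k) ** A" by (simp only: matrix_mul_assoc mpow_Suc)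
  finally show ?case .
qed (simp add: mpow_Suc)

lemma adj_mpow: "adj A = A \<Longrightarrow> adj (mpow A k) = mpow A k"
proof (induction k)
  case (Suc k)
  then have "adj (mpow A (Suc k)) = mpow A k ** A" by (simp add: mpow_Suc adj_mult)
  then show ?case by (simp only: mpow_Suc_right)
qed simp

text \<open>Binomial expansion of the iterated commutator, in the case where the middle term is the
only one that survives.\<close>

lemma trace_ad_power:
  fixes H \<rho> G :: "'n::finite op"
  assumes zero: "\<And>i j. i < m \<or> j < m \<Longrightarrow> trace (mpow H i ** \<rho> ** mpow H j ** G) = 0"
  shows "i + j + k = 2 * m \<Longrightarrow>
    trace ((ad H ^^ k) (mpow H i ** \<rho> ** mpow H j) ** G) =
      (if i \<le> m \<and> j \<le> m then (-1) ^ (m - j) * of_nat (k choose (m - j)) else 0)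
      * trace (mpow H m ** \<rho> ** mpow H m ** G)"
proof (induction k arbitrary: i j)
  case 0
  show ?case
  proof (cases "i = m")
    case False
    then have "i < m \<or> j < m" using 0 by auto
    moreover have "\<not> (i \<le> m \<and> j \<le> m)" using False 0 by linarith
    ultimately show ?thesis using zero[of i j] by auto
  qed (use 0 in auto)
next
  case (Suc k)
  have step: "ad H (mpow H i ** \<rho> ** mpow H j) =
      mpow H (Suc i) ** \<rho> ** mpow H j - mpow H i ** \<rho> ** mpow H (Suc j)"
    unfolding ad_def mpow_Suc[of H i] mpow_Suc_right[of H j] by (simp only: matrix_mul_assoc)
  have "trace ((ad H ^^ Suc k) (mpow H i ** \<rho> ** mpow H j) ** G) =
      trace ((ad H ^^ k) (mpow H (Suc i) ** \<rho> ** mpow H j) ** G)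
      - trace ((ad H ^^ k) (mpow H i ** \<rho> ** mpow H (Suc j)) ** G)"
    by (simp only: funpow_Suc_right o_def step linear_diff[OF linear_ad_funpow] op_sub_rdistrib trace_sub)
  also have "\<dots> = (if Suc i \<le> m \<and> j \<le> m then (-1) ^ (m - j) * of_nat (k choose (m - j)) else 0)
        * trace (mpow H m ** \<rho> ** mpow H m ** G)
      - (if i \<le> m \<and> Suc j \<le> m then (-1) ^ (m - Suc j) * of_nat (k choose (m - Suc j)) else 0)
        * trace (mpow H m ** \<rho> ** mpow H m ** G)"
    using Suc.prems by (subst (1 2) Suc.IH) auto
  also have "\<dots> = (if i \<le> m \<and> j \<le> m then (-1) ^ (m - j) * of_nat (Suc k choose (m - j)) else 0)
      * trace (mpow H m ** \<rho> ** mpow H m ** G)"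
  proof (cases "i \<le> m \<and> j \<le> m")
    case True
    show ?thesis
    proof (cases "j = m")
      case j: True
      then show ?thesis using True Suc.prems by auto
    next
      case False
      \<comment> \<open>The two terms combine by Pascal's rule. For \<open>i = m\<close> the first
        is absent, in accordance with its vanishing binomial coefficient.\<close>
      with True have "m - j = Suc (m - Suc j)" by arith
      moreover have "k choose (m - j) = 0" if "i = m"
        using Suc.prems that by (intro binomial_eq_0) simp
      ultimately show ?thesis using True False by (auto simp: algebra_simps)
    qed
  qed auto
  finally show ?case .
qed

text \<open>Strong induction on \<open>m\<close>. Expanding the commutator of order
  \<open>2 * m\<close>, every term with fewer than \<open>m\<close> factors \<open>H\<close> on one
  side of \<open>\<rho>\<close> vanishes by induction, on the left side after taking adjoints. What
  remains is the middle term with a nonzero central binomial coefficient, and positivity turns its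
  vanishing trace into a vanishing operator.\<close>

lemma psd_form_zero_orbit:
  fixes G H \<rho> :: "'n::finite op"
  assumes G: "\<And>V. 0 \<le> trace (adj V ** G ** V)" and "adj G = G"
    and \<rho>: "psd \<rho>" "adj \<rho> = \<rho>" and H: "adj H = H"
    and zero: "\<And>k. trace ((ad H ^^ k) \<rho> ** G) = 0"
  shows "\<rho> ** mpow H m ** G = 0"
proof (induction m rule: less_induct)
  case (less m)
  have left: "\<rho> ** mpow H j ** G = 0" if "j < m" for j using less that .
  have right: "G ** mpow H j ** \<rho> = 0" if "j < m" for j
    using left[OF that] adj_mult[of "\<rho> ** mpow H j" G]
    by (simp add: adj_mult adj_mpow[OF H] assms matrix_mul_assoc)
  have "trace (mpow H i ** \<rho> ** mpow H j ** G) = 0" if "i < m \<or> j < m" for i j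
  proof (cases "j < m")
    case True
    have "mpow H i ** \<rho> ** mpow H j ** G = mpow H i ** (\<rho> ** mpow H j ** G)"
      by (simp only: matrix_mul_assoc)
    then show ?thesis by (simp add: left[OF True])
  next
    case False
    then have "G ** mpow H i ** \<rho> = 0" using that right by blast
    then have "trace (G ** (mpow H i ** \<rho> ** mpow H j)) = 0"
      by (simp add: matrix_mul_assoc)
    then show ?thesis by (simp only: trace_mul_sym[of G])
  qed
  from trace_ad_power[of m H \<rho> G 0 0 "2 * m", OF this]
  have "(-1) ^ m * of_nat (2 * m choose m) * trace (mpow H m ** \<rho> ** mpow H m ** G) = 0"
    by (simp add: zero)
  then have "trace (mpow H m ** \<rho> ** mpow H m ** G) = 0" by simp
  then have "trace (adj (mpow H m) ** G ** mpow H m ** \<rho>) = 0"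
    unfolding adj_mpow[OF H]
    by (subst (asm) matrix_mul_assoc[symmetric], subst (asm) trace_mul_sym) (simp only: matrix_mul_assoc)
  then have "G ** mpow H m ** \<rho> = 0" by (rule psd_trace_zero[OF G \<rho>(1)])
  then show ?case
    using adj_mult[of "G ** mpow H m" \<rho>]
    by (simp add: adj_mult adj_mpow[OF H] assms matrix_mul_assoc)
qed

section \<open>Unital completely positive maps\<close>

text \<open>\<open>pos\<close> is complete positivity tested on Gram blocks
  \<open>adj (y k) ** y l\<close>, with operators \<open>V k\<close> in place of vectors. Below only
  \<open>n\<close> up to 3 is called upon.\<close>

locale ucp =
  fixes T :: "'m::finite op \<Rightarrow> 'r::finite op"
  assumes clinear: "clinear_map T"
    and unital: "T (mat 1) = mat 1"
    and pos: "0 \<le> (\<Sum>k<n::nat. \<Sum>l<n. trace (adj (V k) ** T (adj (y k) ** y l) ** V l))"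
begin

lemma T_add: "T (x + y) = T x + T y"
  using clinear by (simp add: clinear_map_def)

lemma T_smat: "T (smat c x) = smat c (T x)"
  using clinear by (simp add: clinear_map_def)

text \<open>In the positive form of the pair \<open>y\<close>, \<open>mat 1\<close> the two cross
  terms must be conjugate.\<close>

lemma T_adj: "T (adj y) = adj (T y)"
proof (rule trace_mult_eqI)
  fix W
  have "trace (W ** T y) = cnj (trace (T (adj y) ** adj W))" for W
  proof (rule nonneg_quadratic(1))
    fix c
    show "0 \<le> trace (T (adj y ** y)) + c * trace (T (adj y) ** adj W) + cnj c * trace (W ** T y)
        + c * cnj c * trace (adj (adj W) ** adj W)"
      using pos[where n = 2 and V = "\<lambda>k. if k = 0 then mat 1 else smat c (adj W)"
      and y = "\<lambda>k. if k = 0 then y else mat 1"]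
      by (simp add: eval_nat_numeral adj_smat unital mult_ac add_ac)
  qed (rule trace_adj_self_nonneg)
  from this[of "adj W"] have "trace (adj W ** T y) = trace (adj (T (adj y) ** W))"
    by (simp add: trace_adj)
  then have "cnj (trace (adj W ** T y)) = trace (T (adj y) ** W)"
    by (simp add: trace_adj)
  then have "trace (T (adj y) ** W) = trace (adj (T y) ** W)"
    by (simp add: trace_adj[symmetric] adj_mult)
  then show "trace (W ** T (adj y)) = trace (W ** adj (T y))"
    by (simp only: trace_mul_sym[of W])
qed

text \<open>The Kadison-Schwarz inequality: the weight \<open>- (T y ** V)\<close> on the unit
  completes the square.\<close>

lemma schwarz: "0 \<le> trace (adj V ** (T (adj y ** y) - adj (T y) ** T y) ** V)"
  using pos[where n = 2 and V = "\<lambda>k. if k = 0 then V else - (T y ** V)"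
      and y = "\<lambda>k. if k = 0 then y else mat 1"]
  by (simp add: eval_nat_numeral unital adj_mult adj_minus T_adj matrix_mul_assoc op_distribs
      trace_add trace_sub trace_neg)

text \<open>Equality in the Schwarz inequality makes the pair (y, 1) - (1, T y) a null vector of the
positive form, which is therefore orthogonal to every other vector.\<close>

lemma multiplicative_domain:
  assumes eq: "T (adj y ** y) = adj (T y) ** T y"
  shows "T (x ** y) = T x ** T y"
proof (rule trace_mult_eqI)
  fix W
  define z where "z = trace (T (adj y ** adj x) ** adj W) - trace (adj (T y) ** T (adj x) ** adj W)"
  define z' where "z' = trace (W ** T (x ** y)) - trace (W ** T x ** T y)"
  \<comment> \<open>The first two slots form the null vector; the third, weighted by
    \<open>c\<close>, is the arbitrary vector it is tested against.\<close>
  have *: "0 \<le> 0 + c * z + cnj c * z' + c * cnj c * trace (W ** T (x ** adj x) ** adj W)" for c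
    using pos[where n = 3 and V = "\<lambda>k. if k = 0 then mat 1 else if k = 1 then - T y else smat c (adj W)"
      and y = "\<lambda>k. if k = 0 then y else if k = 1 then mat 1 else adj x"]
    by (simp add: eval_nat_numeral unital adj_smat adj_minus T_adj matrix_mul_assoc eq
        trace_neg z_def z'_def algebra_simps)
  have "0 \<le> trace (W ** T (x ** adj x) ** adj W)"
    using pos[where n = 1 and V = "\<lambda>_. adj W"
      and y = "\<lambda>_. adj x"] by simp
  from nonneg_quadratic[OF * this] have "z' = 0" by simp
  then show "trace (W ** T (x ** y)) = trace (W ** (T x ** T y))"
    by (simp add: z'_def matrix_mul_assoc)
qed

end

section \<open>Fixed points of the local map and their commutant\<close>

locale ucp_local = ucp T for T :: "('r::finite \<times> 's::finite) op \<Rightarrow> 'r op" +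
  fixes H :: "'r op"
  assumes cov: "T (kron (ad H A) (mat 1)) = ad H (T (kron A (mat 1)))"
    and faithful: "T (kron D (mat 1)) = D \<Longrightarrow> T (kron (adj D ** D) (mat 1)) = adj D ** D"
begin

definition \<Theta> :: "'r op \<Rightarrow> 'r op" where
  "\<Theta> A = T (kron A (mat 1))"

definition Fix :: "'r op set" where
  "Fix = {D. \<Theta> D = D}"

definition Comm :: "'r op set" where
  "Comm = {Y. \<forall>D\<in>Fix. Y ** D = D ** Y}"

lemma \<Theta>_ad: "\<Theta> (ad H A) = ad H (\<Theta> A)"
  by (simp add: \<Theta>_def cov)

lemma \<Theta>_adj: "\<Theta> (adj A) = adj (\<Theta> A)"
  by (metis \<Theta>_def T_adj adj_mat_1 kron_adj)

lemma Fix_adj: "D \<in> Fix \<Longrightarrow> adj D \<in> Fix"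
  by (simp add: Fix_def \<Theta>_adj)

text \<open>By \<open>faithful\<close>, \<open>kron D (mat 1)\<close> attains equality in the
  Schwarz inequality and so lies in the multiplicative domain.\<close>

lemma Fix_mult_right:
  assumes "D \<in> Fix"
  shows "T (x ** kron D (mat 1)) = T x ** D"
proof -
  have D: "T (kron D (mat 1)) = D" using assms by (simp add: Fix_def \<Theta>_def)
  have "T (x ** kron D (mat 1)) = T x ** T (kron D (mat 1))"
    by (rule multiplicative_domain) (simp add: kron_adj kron_mult D faithful[OF D])
  then show ?thesis by (simp add: D)
qed

lemma Fix_mult_left:
  assumes "D \<in> Fix"
  shows "T (kron D (mat 1) ** x) = D ** T x"
proof -
  have "adj (T (kron D (mat 1) ** x)) = T (adj x ** kron (adj D) (mat 1))"
    by (simp add: T_adj[symmetric] adj_mult kron_adj)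
  also have "\<dots> = adj (D ** T x)"
    by (simp add: Fix_mult_right[OF Fix_adj[OF assms]] T_adj adj_mult)
  finally show ?thesis by (metis adj_adj)
qed

text \<open>\<open>kron D (mat 1)\<close> commutes with \<open>kron (mat 1) B\<close>, and a fixed
  point \<open>D\<close> can be pulled out of \<open>T\<close> on either side.\<close>

lemma T_kron_1_Comm: "T (kron (mat 1) B) \<in> Comm"
  unfolding Comm_def
  by (auto simp: Fix_mult_left[symmetric] Fix_mult_right[symmetric] kron_mult)

lemma \<Theta>_Comm: "Y \<in> Comm \<Longrightarrow> \<Theta> Y \<in> Comm"
  unfolding Comm_def \<Theta>_def
  by (auto simp: Fix_mult_left[symmetric] Fix_mult_right[symmetric] kron_mult)

lemma ad_Comm_Fix_zero:
  assumes Y: "Y \<in> Comm" and K: "ad H Y \<in> Fix"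
  shows "ad H Y = 0"
proof (rule trace_adj_self_zero)
  let ?K = "adj (ad H Y)"
  have "Y ** ?K = ?K ** Y"
    using Y Fix_adj[OF K] by (simp add: Comm_def)
  then have "trace (?K ** Y ** H) = trace (Y ** ?K ** H)" by simp
  also have "\<dots> = trace (?K ** H ** Y)" by (rule trace_cycle)
  finally show "trace (?K ** ad H Y) = 0"
    by (simp add: ad_def op_sub_ldistrib trace_sub matrix_mul_assoc)
qed

lemma linear_\<Theta>: "linear \<Theta>"
proof (intro linearI)
  show "\<Theta> (A + B) = \<Theta> A + \<Theta> B" for A B
    by (simp add: \<Theta>_def kron_add_left T_add)
  show "\<Theta> (r *\<^sub>R A) = r *\<^sub>R \<Theta> A" for r A
    by (simp add: \<Theta>_def kron_smat_left T_smat flip: smat_of_real)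
qed

lemma subspace_Comm: "subspace Comm"
  by (auto simp: subspace_def Comm_def op_distribs op_scaleR_left op_scaleR_right)

text \<open>A fixed point of \<Theta> in the range of ad H on Comm vanishes, so \<Theta> - 1 is injective, hence
surjective, on that range.\<close>

lemma ad_coboundary:
  assumes "C \<in> Comm"
  obtains Y where "ad H C = \<Theta> Y - Y"
proof -
  define W where "W = ad H ` Comm"
  define g where "g = (\<lambda>Y. \<Theta> Y - Y)"
  have g: "linear g" unfolding g_def by (intro linear_compose_sub linear_\<Theta> linear_id[unfolded id_def])
  have W: "subspace W" unfolding W_def by (intro linear_subspace_image linear_ad subspace_Comm)
  have gW: "g ` W \<subseteq> W"
  proof
    fix Z assume "Z \<in> g ` W"
    then obtain Y where Y: "Y \<in> Comm" "Z = \<Theta> (ad H Y) - ad H Y" by (auto simp: W_def g_def)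
    then have "\<Theta> Y - Y \<in> Comm" by (intro subspace_diff[OF subspace_Comm] \<Theta>_Comm)
    moreover have "Z = ad H (\<Theta> Y - Y)"
      by (simp add: Y \<Theta>_ad linear_diff[OF linear_ad])
    ultimately show "Z \<in> W" by (auto simp: W_def)
  qed
  have "Y = 0" if "Y \<in> W" "g Y = 0" for Y
    using that ad_Comm_Fix_zero by (auto simp: W_def g_def Fix_def)
  then have "inj_on g W" using linear_inj_on_iff_eq_0[OF g W] by blast
  then have "inj_on g (span W)" by (simp only: span_eq_iff[THEN iffD2, OF W])
  then have "dim (g ` W) = dim W" by (rule dim_image_eq[OF g])
  then have "g ` W = W"
    by (intro subspace_dim_equal linear_subspace_image[OF g W] W gW) simp
  moreover have "ad H C \<in> W" using assms by (simp add: W_def)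
  ultimately show ?thesis using that by (auto simp: g_def)
qed

end

section \<open>Channels\<close>

lemma trace_sandwich:
  "trace (adj A ** X ** B) = (\<Sum>a\<in>UNIV. \<Sum>i\<in>UNIV. \<Sum>j\<in>UNIV. cnj (A $ i $ a) * X $ i $ j * B $ j $ a)"
  unfolding trace_def matrix_matrix_mult_def
  by (simp add: sum_distrib_right) (rule sum.cong[OF refl], rule sum.swap)

text \<open>The trace form is the vector form summed over the columns of the \<open>Y k\<close>.
  This brings complete positivity into the shape used in \<open>ucp\<close>.\<close>

lemma psd_block_iff:
  "psd_block n X \<longleftrightarrow> (\<forall>Y. 0 \<le> (\<Sum>k<n. \<Sum>l<n. trace (adj (Y k) ** X k l ** Y l)))"
proof -
  define q where "q v = (\<Sum>k<n. \<Sum>l<n. \<Sum>i\<in>UNIV. \<Sum>j\<in>UNIV. cnj (v k $ i) * X k l $ i $ j * v l $ j)" for v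
  have col: "(\<Sum>k<n. \<Sum>l<n. trace (adj (Y k) ** X k l ** Y l)) =
      (\<Sum>a\<in>UNIV. q (\<lambda>k. column a (Y k)))" for Y :: "nat \<Rightarrow> 'a op"
    unfolding trace_sandwich q_def column_def
    by (simp add: sum.swap[of _ UNIV "{..<n}"])
  have "psd_block n X \<longleftrightarrow> (\<forall>v. 0 \<le> q v)"
    by (simp add: psd_block_def q_def nonneg_iff Let_def)
  also have "\<dots> \<longleftrightarrow> (\<forall>Y. 0 \<le> (\<Sum>a\<in>UNIV. q (\<lambda>k. column a (Y k :: 'a op))))"
  proof safe
    fix Y :: "nat \<Rightarrow> 'a op" assume "\<forall>v. 0 \<le> q v"
    then show "0 \<le> (\<Sum>a\<in>UNIV. q (\<lambda>k. column a (Y k)))" by (simp add: sum_nonneg)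
  next
    fix v assume *: "\<forall>Y. 0 \<le> (\<Sum>a\<in>UNIV. q (\<lambda>k. column a (Y k :: 'a op)))"
    \<comment> \<open>An arbitrary column index: the vectors \<open>v k\<close> are placed in this
      one column.\<close>
    define b :: 'a where "b = undefined"
    define Y :: "nat \<Rightarrow> 'a op" where "Y k = (\<chi> i a. if a = b then v k $ i else 0)" for k
    have "q (\<lambda>k. column a (Y k)) = (if a = b then q v else 0)" for a
      by (simp add: q_def Y_def column_def)
    then show "0 \<le> q v" using *[rule_format, of Y] by simp
  qed
  finally show ?thesis by (simp add: col)
qed

lemma adj_sum: "adj (\<Sum>k\<in>A. f k) = (\<Sum>k\<in>A. adj (f k))"
  by (simp add: vec_eq_iff)

lemma op_sum_left: "(\<Sum>k\<in>A. f k) ** (B :: 'n::finite op) = (\<Sum>k\<in>A. f k ** B)"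
  for f :: "'a \<Rightarrow> 'n::finite op"
  by (induction A rule: infinite_finite_induct) (simp_all add: op_distribs)

lemma op_sum_right: "(B :: 'n::finite op) ** (\<Sum>k\<in>A. f k) = (\<Sum>k\<in>A. B ** f k)"
  for f :: "'a \<Rightarrow> 'n::finite op"
  by (induction A rule: infinite_finite_induct) (simp_all add: op_distribs)

lemma trace_sum: "trace (\<Sum>k\<in>A. f k :: 'n::finite op) = (\<Sum>k\<in>A. trace (f k))"
  by (induction A rule: infinite_finite_induct) (simp_all add: trace_add)

lemma gram_nonneg: "0 \<le> (\<Sum>k<n. \<Sum>l<n. trace (adj (Z k) ** Z l))" for n :: nat
proof -
  have "(\<Sum>k<n. \<Sum>l<n. trace (adj (Z k) ** Z l)) = trace (adj (\<Sum>k<n. Z k) ** (\<Sum>k<n. Z k))"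
    unfolding adj_sum op_sum_left op_sum_right trace_sum by (rule sum.swap)
  then show ?thesis by (simp add: trace_adj_self_nonneg)
qed

lemma psd_block_gram: "psd_block n (\<lambda>k l. M k ** adj (M l))"
  unfolding psd_block_iff
proof
  fix Y :: "nat \<Rightarrow> 'a op"
  show "0 \<le> (\<Sum>k<n. \<Sum>l<n. trace (adj (Y k) ** (M k ** adj (M l)) ** Y l))"
    using gram_nonneg[of "\<lambda>k. adj (M k) ** Y k" n] by (simp add: adj_mult matrix_mul_assoc)
qed

text \<open>The blocks are tested on \<open>adj (y k)\<close>; cycling the trace exchanges the roles
  of \<open>k\<close> and \<open>l\<close>, whence the order
  \<open>M l ** adj (M k)\<close>.\<close>

lemma completely_positive_trace_nonneg:
  fixes E :: "'n::finite op \<Rightarrow> 'n op"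
  assumes "completely_positive E"
  shows "0 \<le> (\<Sum>k<n::nat. \<Sum>l<n. trace (E (M l ** adj (M k)) ** (adj (y k) ** y l)))"
proof -
  have "psd_block n (\<lambda>k l. E (M k ** adj (M l)))"
    using assms psd_block_gram unfolding completely_positive_def by blast
  from this[unfolded psd_block_iff, THEN spec, of "\<lambda>k. adj (y k)"]
  have "0 \<le> (\<Sum>k<n. \<Sum>l<n. trace (adj (adj (y k)) ** E (M k ** adj (M l)) ** adj (y l)))" .
  also have "\<dots> = (\<Sum>k<n. \<Sum>l<n. trace (E (M k ** adj (M l)) ** (adj (y l) ** y k)))"
    by (intro sum.cong refl) (simp only: adj_adj trace_cycle[of "y _"], simp only: matrix_mul_assoc)
  also have "\<dots> = (\<Sum>k<n. \<Sum>l<n. trace (E (M l ** adj (M k)) ** (adj (y k) ** y l)))"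
    by (rule sum.swap)
  finally show ?thesis .
qed

definition munit :: "'n::finite \<Rightarrow> 'n \<Rightarrow> 'n op" where
  "munit k l = (\<chi> i j. if i = k \<and> j = l then 1 else 0)"

text \<open>The Heisenberg picture of F with respect to the pairing (X, y) -> tr (X y).\<close>

definition dual_map :: "('n::finite op \<Rightarrow> 'm::finite op) \<Rightarrow> 'm op \<Rightarrow> 'n op" where
  "dual_map F y = (\<chi> l k. trace (F (munit k l) ** y))"

text \<open>By linearity it suffices to expand \<open>X\<close> in the matrix units.\<close>

lemma trace_dual_map:
  assumes "clinear_map F"
  shows "trace (X ** dual_map F y) = trace (F X ** y)"
proof -
  have "linear F"
    using clinear_bounded_linear[OF assms] by (simp add: linear_conv_bounded_linear)
  note sum = linear_sum[OF this]
  have "X = (\<Sum>k\<in>UNIV. \<Sum>l\<in>UNIV. smat (X $ k $ l) (munit k l))"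
  proof (simp add: vec_eq_iff, intro allI)
    fix i j
    have "(\<Sum>l\<in>UNIV. X $ k $ l * munit k l $ i $ j) = (if k = i then X $ i $ j else 0)" for k
    proof -
      have "(\<Sum>l\<in>UNIV. X $ k $ l * munit k l $ i $ j) =
          (\<Sum>l\<in>UNIV. if l = j then if k = i then X $ i $ j else 0 else 0)"
        by (intro sum.cong) (auto simp: munit_def)
      then show ?thesis by simp
    qed
    then show "X $ i $ j = (\<Sum>k\<in>UNIV. \<Sum>l\<in>UNIV. X $ k $ l * munit k l $ i $ j)" by simp
  qed
  then have "F X = F (\<Sum>k\<in>UNIV. \<Sum>l\<in>UNIV. smat (X $ k $ l) (munit k l))" by simp
  also have "\<dots> = (\<Sum>k\<in>UNIV. \<Sum>l\<in>UNIV. smat (X $ k $ l) (F (munit k l)))"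
    using assms by (simp add: sum clinear_map_def)
  finally have "trace (F X ** y) = (\<Sum>k\<in>UNIV. \<Sum>l\<in>UNIV. X $ k $ l * trace (F (munit k l) ** y))"
    by (simp add: op_sum_left trace_sum)
  also have "\<dots> = trace (X ** dual_map F y)"
  proof -
    have "trace (X ** D) = (\<Sum>k\<in>UNIV. \<Sum>l\<in>UNIV. X $ k $ l * D $ l $ k)" for D
      by (simp add: trace_def matrix_matrix_mult_def)
    then show ?thesis by (simp add: dual_map_def)
  qed
  finally show ?thesis by simp
qed

lemma clinear_dual_map: "clinear_map (dual_map F)"
  by (simp add: clinear_map_def dual_map_def vec_eq_iff op_distribs trace_add)

section \<open>Commutators with the total Hamiltonian under partial traces\<close>

lemma trace_ad: "trace (ad K X ** Y) = - trace (X ** ad K Y)"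
  using trace_cycle[of K X Y]
  by (simp add: ad_def op_distribs trace_sub matrix_mul_assoc)

lemma kron_diff_right: "kron A (B - B') = kron A B - kron A B'"
  by (simp add: vec_eq_iff algebra_simps)

lemma ad_ham_sum_kron:
  "ad (ham_sum HR HS) (kron X Y) = kron (ad HR X) Y + kron X (ad HS Y)"
  by (simp add: ad_def ham_sum_def op_distribs kron_mult kron_diff_left kron_diff_right)

lemma ad_mat_1 [simp]: "ad H (mat 1) = 0"
  by (simp add: ad_def)

lemma kron_zero_right [simp]: "kron A 0 = 0"
  by (simp add: vec_eq_iff)

text \<open>Tested on \<open>kron W (mat 1)\<close>, the part of the Hamiltonian acting on S drops
  out because it commutes with this observable.\<close>

lemma ptrace_2_ad: "ptrace_2 (ad (ham_sum HR HS) Z) = ad HR (ptrace_2 Z)"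
proof (rule trace_mult_eqI)
  fix W
  have "trace (ptrace_2 (ad (ham_sum HR HS) Z) ** W) = trace (ad HR (ptrace_2 Z) ** W)"
    by (simp add: trace_ad ad_ham_sum_kron flip: trace_kron_1_right)
  then show "trace (W ** ptrace_2 (ad (ham_sum HR HS) Z)) = trace (W ** ad HR (ptrace_2 Z))"
    by (simp only: trace_mul_sym[of W])
qed

lemma ptrace_1_ad: "ptrace_1 (ad (ham_sum HR HS) Z) = ad HS (ptrace_1 Z)"
proof (rule trace_mult_eqI)
  fix W
  have "trace (ptrace_1 (ad (ham_sum HR HS) Z) ** W) = trace (ad HS (ptrace_1 Z) ** W)"
    by (simp add: trace_ad ad_ham_sum_kron flip: trace_kron_1_left)
  then show "trace (W ** ptrace_1 (ad (ham_sum HR HS) Z)) = trace (W ** ad HS (ptrace_1 Z))"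
    by (simp only: trace_mul_sym[of W])
qed

section \<open>Catalytic channels\<close>

locale catalyst =
  fixes HR \<rho>R :: "'r::finite op" and HS \<rho>S :: "'s::finite op"
    and E :: "('r \<times> 's) op \<Rightarrow> ('r \<times> 's) op"
  assumes HR: "adj HR = HR"
    and \<rho>R: "psd \<rho>R" and \<rho>S: "psd \<rho>S" "trace \<rho>S = 1"
    and comm: "ad HS \<rho>S = 0"
    and E_lin: "clinear_map E" and E_trace: "trace (E X) = trace X" and E_cp: "completely_positive E"
    and E_ad: "E (ad (ham_sum HR HS) Z) = ad (ham_sum HR HS) (E Z)"
    and fixed: "ptrace_2 (E (kron \<rho>R \<rho>S)) = \<rho>R"
begin

lemma \<rho>R_adj: "adj \<rho>R = \<rho>R"
  by (rule psd_gram[OF \<rho>R]) (simp add: adj_mult)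

text \<open>The operators whose columns are orthogonal to the smallest \<open>HR\<close>-invariant
  subspace containing the range of \<open>\<rho>R\<close>, as \<open>\<rho>R\<close> and
  \<open>HR\<close> are self-adjoint.\<close>

definition Null :: "'r op set" where
  "Null = {M. \<forall>k. \<rho>R ** mpow HR k ** M = 0}"

lemma Null_projection:
  obtains Q where "Q \<in> Null" "adj Q = Q" "Q ** Q = Q" "\<And>M. M \<in> Null \<Longrightarrow> Q ** M = M"
proof -
  have sub: "subspace Null"
    by (auto simp: subspace_def Null_def matrix_add_ldistrib op_scaleR_right)
  have ideal: "M ** N \<in> Null" if "M \<in> Null" for M N
    using that by (simp add: Null_def matrix_mul_assoc)
  show ?thesis by (rule right_ideal_projection[OF sub ideal]) (assumption, rule that)
qed

lemma HR_Null:
  assumes "M \<in> Null" shows "HR ** M \<in> Null"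
proof -
  have "\<rho>R ** mpow HR k ** (HR ** M) = \<rho>R ** mpow HR (Suc k) ** M" for k
    by (simp only: mpow_Suc_right matrix_mul_assoc)
  then show ?thesis using assms by (simp add: Null_def)
qed

end

section \<open>The channel modified off the invariant subspace\<close>

locale catalyst_projection = catalyst HR \<rho>R HS \<rho>S E
  for HR \<rho>R :: "'r::finite op" and HS \<rho>S :: "'s::finite op" and E +
  fixes Q :: "'r op"
  assumes Q_Null: "Q \<in> Null" and Q_adj: "adj Q = Q" and Q_idem: "Q ** Q = Q"
    and Q_fix: "M \<in> Null \<Longrightarrow> Q ** M = M"
begin

definition P :: "'r op" where "P = mat 1 - Q"

text \<open>Invariance of \<open>Null\<close> gives \<open>Q ** HR ** Q = HR ** Q\<close>, and the
  adjoint of this identity gives \<open>Q ** HR\<close>.\<close>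

lemma Q_commute: "HR ** Q = Q ** HR"
proof -
  have 1: "Q ** (HR ** Q) = HR ** Q" by (rule Q_fix[OF HR_Null[OF Q_Null]])
  from arg_cong[OF this, of adj] have "Q ** HR ** Q = Q ** HR"
    by (simp add: adj_mult Q_adj HR matrix_mul_assoc)
  with 1 show ?thesis by (simp add: matrix_mul_assoc)
qed

lemma P_adj: "adj P = P" by (simp add: P_def adj_diff Q_adj)

lemma P_idem: "P ** P = P" by (simp add: P_def op_distribs Q_idem)

lemma P_Q: "P ** Q = 0" by (simp add: P_def op_distribs Q_idem)

lemma P_commute: "HR ** P = P ** HR" by (simp add: P_def op_distribs Q_commute)

lemma ad_sandwich:
  assumes "HR ** K = K ** HR"
  shows "K ** ad HR X ** K = ad HR (K ** X ** K)"
proof -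
  have "K ** ad HR X ** K = (K ** HR) ** X ** K - K ** X ** (HR ** K)"
    by (simp only: ad_def op_distribs matrix_mul_assoc)
  also have "\<dots> = ad HR (K ** X ** K)"
    unfolding assms[symmetric] unfolding assms unfolding ad_def matrix_mul_assoc assms ..
  finally show ?thesis .
qed

lemma \<rho>R_Q: "\<rho>R ** Q = 0"
proof -
  have "\<rho>R ** mpow HR 0 ** Q = 0" using Q_Null unfolding Null_def by blast
  then show ?thesis by simp
qed

lemma Q_\<rho>R: "Q ** \<rho>R = 0"
  using arg_cong[OF \<rho>R_Q, of adj] by (simp add: adj_mult Q_adj \<rho>R_adj)

lemma P_\<rho>R_P: "P ** \<rho>R ** P = \<rho>R"
  by (simp add: P_def op_distribs \<rho>R_Q Q_\<rho>R)

text \<open>Redefining the channel on the complement of P so that it fixes Q makes the fixed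
functionals separate the positive operators, while the action on \<rho>R is unchanged.\<close>

definition F :: "'r op \<Rightarrow> ('r \<times> 's) op" where
  "F X = E (kron (P ** X ** P) \<rho>S) + kron (Q ** X ** Q) \<rho>S"

abbreviation T :: "('r \<times> 's) op \<Rightarrow> 'r op" where "T \<equiv> dual_map F"

text \<open>The predual of the local map \<open>A \<mapsto> T (kron A (mat 1))\<close>.\<close>

definition \<Lambda> :: "'r op \<Rightarrow> 'r op" where "\<Lambda> X = ptrace_2 (F X)"

lemma F_clinear: "clinear_map F"
  using E_lin unfolding clinear_map_def F_def
  by (simp add: op_distribs kron_add_left kron_smat_left) (simp add: vec_eq_iff algebra_simps)

lemma trace_T: "trace (X ** T y) = trace (F X ** y)"
  by (rule trace_dual_map[OF F_clinear])

lemma trace_F: "trace (F X) = trace X"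
proof -
  have "trace (F X) = trace (P ** X ** P) + trace (Q ** X ** Q)"
    by (simp add: F_def trace_add E_trace trace_kron \<rho>S)
  also have "\<dots> = trace (X ** (P ** P)) + trace (X ** (Q ** Q))"
    by (simp only: trace_cycle[of P] trace_cycle[of Q]) (simp only: matrix_mul_assoc)
  also have "\<dots> = trace X"
    by (simp add: P_idem Q_idem) (simp add: P_def op_distribs trace_sub)
  finally show ?thesis .
qed

lemma ucp_T: "ucp T"
proof
  show "clinear_map T" by (rule clinear_dual_map)
  show "T (mat 1) = mat 1"
    by (rule trace_mult_eqI) (simp add: trace_T trace_F)
  fix n :: nat and V :: "nat \<Rightarrow> 'r op" and y :: "nat \<Rightarrow> ('r \<times> 's) op"
  obtain R where R: "\<rho>S = R ** adj R" using psd_gram[OF \<rho>S(1)] .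
  \<comment> \<open>Gram factors of the two summands of \<open>F (V l ** adj (V k))\<close>, the
    first before \<open>E\<close> is applied.\<close>
  define M where "M k = kron (P ** V k) R" for k
  define N where "N k = kron (Q ** V k) R" for k
  have gram: "kron (K ** (V l ** adj (V k)) ** K) \<rho>S = kron (K ** V l) R ** adj (kron (K ** V k) R)"
    if "adj K = K" for K k l
    by (simp add: R kron_adj kron_mult adj_mult that matrix_mul_assoc)
  have F: "F (V l ** adj (V k)) = E (M l ** adj (M k)) + N l ** adj (N k)" for k l
    by (simp only: F_def M_def N_def gram[OF P_adj] gram[OF Q_adj])
  have "0 \<le> (\<Sum>k<n. \<Sum>l<n. trace (E (M l ** adj (M k)) ** (adj (y k) ** y l)))
      + (\<Sum>k<n. \<Sum>l<n. trace (adj (y k ** N k) ** (y l ** N l)))"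
    by (intro add_nonneg_nonneg completely_positive_trace_nonneg[OF E_cp] gram_nonneg)
  also have "\<dots> = (\<Sum>k<n. \<Sum>l<n. trace (F (V l ** adj (V k)) ** (adj (y k) ** y l)))"
  proof -
    have "trace (adj (y k ** N k) ** (y l ** N l)) =
        trace (N l ** adj (N k) ** (adj (y k) ** y l))" for k l
      by (subst trace_cycle[of "N l"]) (simp only: adj_mult matrix_mul_assoc)
    then show ?thesis by (simp add: F op_add_rdistrib trace_add sum.distrib)
  qed
  also have "\<dots> = (\<Sum>k<n. \<Sum>l<n. trace (adj (V k) ** T (adj (y k) ** y l) ** V l))"
    unfolding trace_T[symmetric]
    by (intro sum.cong refl, subst trace_cycle[of "V _"]) (simp only: matrix_mul_assoc)
  finally show "0 \<le> (\<Sum>k<n. \<Sum>l<n. trace (adj (V k) ** T (adj (y k) ** y l) ** V l))" .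
qed

lemma \<Lambda>_eq: "\<Lambda> X = ptrace_2 (E (kron (P ** X ** P) \<rho>S)) + Q ** X ** Q"
  by (simp add: \<Lambda>_def F_def ptrace_2_add ptrace_2_kron \<rho>S) (simp add: vec_eq_iff)

lemma trace_T_local: "trace (X ** T (kron A (mat 1))) = trace (\<Lambda> X ** A)"
  by (simp add: trace_T trace_kron_1_right \<Lambda>_def)

lemma E_ad_kron: "E (kron (ad HR X) \<rho>S) = ad (ham_sum HR HS) (E (kron X \<rho>S))"
  using E_ad[of "kron X \<rho>S"] by (simp add: ad_ham_sum_kron comm)

text \<open>\<open>P\<close> and \<open>Q\<close> commute with \<open>HR\<close>,
  \<open>\<rho>S\<close> with \<open>HS\<close>, and tracing out S leaves only
  \<open>HR\<close>.\<close>

lemma \<Lambda>_ad: "\<Lambda> (ad HR X) = ad HR (\<Lambda> X)"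
proof -
  have "\<Lambda> (ad HR X) = ad HR (ptrace_2 (E (kron (P ** X ** P) \<rho>S))) + ad HR (Q ** X ** Q)"
    unfolding \<Lambda>_eq ad_sandwich[OF P_commute] ad_sandwich[OF Q_commute] E_ad_kron ptrace_2_ad ..
  also have "\<dots> = ad HR (\<Lambda> X)" unfolding \<Lambda>_eq by (rule linear_add[OF linear_ad, symmetric])
  finally show ?thesis .
qed

lemma \<Lambda>_\<rho>R: "\<Lambda> \<rho>R = \<rho>R"
  by (simp add: \<Lambda>_eq P_\<rho>R_P fixed Q_\<rho>R)

lemma \<Lambda>_ad_\<rho>R: "\<Lambda> ((ad HR ^^ k) \<rho>R) = (ad HR ^^ k) \<rho>R"
  by (induction k) (simp_all add: \<Lambda>_\<rho>R \<Lambda>_ad)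

lemma \<Lambda>_Q: "\<Lambda> Q = Q"
proof -
  have "E 0 = 0" using linear_0[OF bounded_linear.linear[OF clinear_bounded_linear[OF E_lin]]] .
  then show ?thesis by (simp add: \<Lambda>_eq P_Q Q_idem) (simp add: vec_eq_iff)
qed

sublocale ucp_T: ucp T by (rule ucp_T)

lemma T_local_ad: "T (kron (ad HR A) (mat 1)) = ad HR (T (kron A (mat 1)))"
proof (rule trace_mult_eqI)
  fix W
  have "trace (W ** T (kron (ad HR A) (mat 1))) = - trace (\<Lambda> (ad HR W) ** A)"
    unfolding trace_T_local \<Lambda>_ad trace_ad by simp
  also have "\<dots> = trace (W ** ad HR (T (kron A (mat 1))))"
    unfolding trace_T_local[symmetric] trace_ad by simp
  finally show "trace (W ** T (kron (ad HR A) (mat 1))) = trace (W ** ad HR (T (kron A (mat 1))))" .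
qed

text \<open>The Schwarz defect \<open>G\<close> is positive and annihilated by every functional that
  \<open>\<Lambda>\<close> fixes. The orbit of \<open>\<rho>R\<close> puts \<open>G\<close> into
  \<open>Null\<close>, so \<open>G\<close> lives on the range of \<open>Q\<close>; there the fixed
  functional \<open>Q\<close> is faithful and forces \<open>G = 0\<close>.\<close>

lemma T_local_faithful:
  assumes D: "T (kron D (mat 1)) = D"
  shows "T (kron (adj D ** D) (mat 1)) = adj D ** D"
proof -
  define G where "G = T (kron (adj D ** D) (mat 1)) - adj D ** D"
  have G: "0 \<le> trace (adj V ** G ** V)" for V
    using ucp_T.schwarz[of V "kron D (mat 1)"] by (simp add: G_def kron_adj kron_mult D)
  have "adj G = G"
    by (simp add: G_def adj_diff adj_mult kron_adj flip: ucp_T.T_adj)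
  have zero: "trace (X ** G) = 0" if "\<Lambda> X = X" for X
    by (simp add: G_def op_distribs trace_sub trace_T_local that)
  have "\<rho>R ** mpow HR m ** G = 0" for m
    by (rule psd_form_zero_orbit[OF G \<open>adj G = G\<close> \<rho>R \<rho>R_adj HR])
      (rule zero[OF \<Lambda>_ad_\<rho>R])
  then have "Q ** G = G" by (intro Q_fix) (simp add: Null_def)
  then have "G ** Q = G"
    using adj_mult[of Q G] by (simp add: \<open>adj G = G\<close> Q_adj)
  have "trace (adj Q ** G ** Q) = 0"
    using zero[OF \<Lambda>_Q] by (simp add: Q_adj \<open>Q ** G = G\<close> \<open>G ** Q = G\<close>)
  then have "G ** Q = 0" by (rule psd_form_zero[OF G])
  then have "G = 0" by (simp add: \<open>G ** Q = G\<close>)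
  then show ?thesis by (simp add: G_def)
qed

sublocale ucp_T: ucp_local T HR
  by unfold_locales (fact T_local_ad T_local_faithful)+

lemma ptrace_1_incoherent: "ad HS (ptrace_1 (E (kron \<rho>R \<rho>S))) = 0"
proof (rule trace_mult_zero_imp_zero)
  fix B
  define C where "C = T (kron (mat 1) B)"
  obtain Y where Y: "ad HR C = ucp_T.\<Theta> Y - Y"
    unfolding C_def by (rule ucp_T.ad_coboundary[OF ucp_T.T_kron_1_Comm])
  \<comment> \<open>Invariance of \<open>\<rho>R\<close> under \<open>\<Lambda>\<close> kills the
    coboundary.\<close>
  have "trace (\<rho>R ** ad HR C) = 0"
    by (simp add: Y op_distribs trace_sub ucp_T.\<Theta>_def trace_T_local \<Lambda>_\<rho>R)
  then have "trace (ad HR \<rho>R ** C) = 0" by (simp add: trace_ad)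
  then have "trace (ptrace_1 (F (ad HR \<rho>R)) ** B) = 0"
    by (simp add: C_def trace_T trace_kron_1_left)
  \<comment> \<open>On \<open>\<rho>R\<close> the \<open>Q\<close> summand vanishes and
    \<open>P\<close> acts trivially, so the modified map agrees with the original channel.\<close>
  moreover have "F (ad HR \<rho>R) = ad (ham_sum HR HS) (E (kron \<rho>R \<rho>S))"
    unfolding F_def ad_sandwich[OF P_commute] ad_sandwich[OF Q_commute] P_\<rho>R_P E_ad_kron Q_\<rho>R
    by (simp add: ad_def)
  ultimately show "trace (B ** ad HS (ptrace_1 (E (kron \<rho>R \<rho>S)))) = 0"
    by (simp add: ptrace_1_ad trace_mul_sym[of B])
qed

end

theorem theorem1:
  fixes HR :: "complex^'r::finite^'r" and HS :: "complex^'s::finite^'s"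
    and \<rho>R :: "complex^'r^'r" and \<rho>S :: "complex^'s^'s"
    and E :: "complex^('r \<times> 's)^('r \<times> 's) \<Rightarrow> complex^('r \<times> 's)^('r \<times> 's)"
  assumes "hermitian HR" and "hermitian HS"
    and "is_state \<rho>R" and "is_state \<rho>S"
    and "\<rho>S ** HS = HS ** \<rho>S"
    and "channel E" and "tt_covariant HR HS E"
    and "ptrace_2 (E (kron \<rho>R \<rho>S)) = \<rho>R"
  shows "ptrace_1 (E (kron \<rho>R \<rho>S)) ** HS = HS ** ptrace_1 (E (kron \<rho>R \<rho>S))"
proof -
  have "clinear_map E" using \<open>channel E\<close> by (simp add: channel_def)
  moreover have "E (ad (ham_sum HR HS) Z) = ad (ham_sum HR HS) (E Z)" for Z
    using \<open>tt_covariant HR HS E\<close> covariant_ad[OF \<open>clinear_map E\<close>] by (simp add: tt_covariant_def)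
  ultimately interpret catalyst HR \<rho>R HS \<rho>S E
    using assms by unfold_locales (auto simp: hermitian_def is_state_def channel_def ad_def)
  obtain Q where "Q \<in> Null" "adj Q = Q" "Q ** Q = Q" "\<And>M. M \<in> Null \<Longrightarrow> Q ** M = M"
    by (rule Null_projection) blast
  then interpret catalyst_projection HR \<rho>R HS \<rho>S E Q by unfold_locales
  show ?thesis using ptrace_1_incoherent by (simp add: ad_def)
qed

end
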